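(* Let $\mu$ be a translation invariant product probability measure on $\mathbb{N}^{\mathbb{Z}}$ (i.e. the heights $\eta(x)$, $x\in\mathbb{Z}$, are i.i.d.) with density $\mathbb{E}_\mu(\eta(0))=1$ and such that $\mu(\eta(0)=0)>0$. Then $\mu$ is not stabilizable.
   Context: Sandpile model on $\mathbb{Z}$ ($d=1$): a configuration $\eta\in\mathbb{N}^{\mathbb{Z}}$ is stable if $\eta(x)\le 1$ for all $x$; toppling an unstable site $x$ (with $\eta(x)\ge 2$) removes 2 grains from $x$ and adds one to each of $x-1,x+1$. A toppling procedure is a measurable map $T:[0,\infty)\times\mathbb{Z}\times\mathbb{N}^{\mathbb{Z}}\to\mathbb{N}$ ($T(t,x,\eta)$ = number of topplings at $x$ up to time $t$) with $T(0,\cdot,\eta)=0$, $t\mapsto T(t,x,\eta)$ right-continuous, nondecreasing, with jumps of size at most one and finitely many jumps in finite time intervals, and with no infinite chain of topplings at neighboring sites $x_1,x_2,\dots$ occurring at decreasing times $t_1>t_2>\cdots$. It is legal if only unstable sites (in the current configuration $\eta_{t-}=\eta-\Delta T(t-,\cdot,\eta)$, $\Delta_{x,y}=2\mathbf{1}_{x=y}-\mathbf{1}_{|x-y|=1}$) topple. A configuration is stabilizable if some legal toppling procedure has $T(\infty,x,\eta)<\infty$ for all $x$ and a stable final configuration $\eta-\Delta T(\infty,\cdot,\eta)$; a measure $\mu$ is stabilizable if $\mu$-a.e. configuration is stabilizable. *)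

theory Defs
  imports "HOL-Probability.Probability"
begin

type_synonym config = "int \<Rightarrow> nat"
type_synonym procedure = "real \<Rightarrow> int \<Rightarrow> nat"
  (* T t x = number of topplings at site x up to time t (for a fixed initial configuration) *)

definition leftval :: "procedure \<Rightarrow> real \<Rightarrow> int \<Rightarrow> nat" where
  "leftval T t x = (if t \<le> 0 then T 0 x else Sup {T s x | s. 0 \<le> s \<and> s < t})"

definition topples_at :: "procedure \<Rightarrow> int \<Rightarrow> real \<Rightarrow> bool" where
  "topples_at T x t \<longleftrightarrow> t > 0 \<and> leftval T t x < T t x"

definition toppling_procedure :: "procedure \<Rightarrow> bool" where
  "toppling_procedure T \<longleftrightarrow>
     (\<forall>x. T 0 x = 0)
   \<and> (\<forall>x s t. 0 \<le> s \<longrightarrow> s \<le> t \<longrightarrow> T s x \<le> T t x)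
   \<and> (\<forall>x t. 0 \<le> t \<longrightarrow> (\<forall>\<^sub>F s in at_right t. T s x = T t x))
   \<and> (\<forall>x t. 0 < t \<longrightarrow> T t x \<le> leftval T t x + 1)
   \<and> (\<forall>x b. finite {t. t \<le> b \<and> topples_at T x t})
   \<and> \<not> (\<exists>(xs :: nat \<Rightarrow> int) (ts :: nat \<Rightarrow> real).
          (\<forall>n. \<bar>xs (Suc n) - xs n\<bar> = 1 \<and> ts (Suc n) < ts n \<and> topples_at T (xs n) (ts n)))"

definition lap :: "(int \<Rightarrow> nat) \<Rightarrow> int \<Rightarrow> int" where
  "lap f x = 2 * int (f x) - int (f (x - 1)) - int (f (x + 1))"

definition current_config :: "config \<Rightarrow> procedure \<Rightarrow> real \<Rightarrow> int \<Rightarrow> int" where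
  "current_config \<eta> T t x = int (\<eta> x) - lap (leftval T t) x"

definition legal :: "config \<Rightarrow> procedure \<Rightarrow> bool" where
  "legal \<eta> T \<longleftrightarrow> (\<forall>x t. topples_at T x t \<longrightarrow> current_config \<eta> T t x \<ge> 2)"

definition Tinf :: "procedure \<Rightarrow> int \<Rightarrow> nat" where
  "Tinf T x = Sup {T t x | t. 0 \<le> t}"

definition stabilizable :: "config \<Rightarrow> bool" where
  "stabilizable \<eta> \<longleftrightarrow> (\<exists>T. toppling_procedure T \<and> legal \<eta> T
      \<and> (\<forall>x. bdd_above {T t x | t. 0 \<le> t})
      \<and> (\<forall>x. int (\<eta> x) - lap (Tinf T) x \<le> 1))"

definition iid_measure :: "nat pmf \<Rightarrow> config measure" where
  "iid_measure p = PiM (UNIV :: int set) (\<lambda>_. measure_pmf p)"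

definition stabilizable_measure :: "config measure \<Rightarrow> bool" where
  "stabilizable_measure \<mu> \<longleftrightarrow> (AE \<eta> in \<mu>. stabilizable \<eta>)"

end

theory Submission
  imports Defs
begin

text \<open>
  Stabilizability provides a function \<open>f\<close> on the integers with \<open>\<eta> - lap f \<le> 1\<close>. The pointwise
  least such function \<open>F\<close> commutes with translations, so \<open>F\<close> is a stationary process. Its
  increments \<open>G x = F x - F (x - 1)\<close> satisfy \<open>1 - (G 1 - G 0) = 1 + lap F 0 \<ge> \<eta> 0\<close>. A stationary
  process whose increments are bounded above has mean increment at least \<open>0\<close> (truncate and apply
  Fatou), so the left-hand side has mean at most \<open>1\<close>, which is also the mean of \<open>\<eta> 0\<close>. Hence
  \<open>lap F = \<eta> - 1\<close> almost surely.

  Now exchange the heights at \<open>0\<close> and \<open>m\<close>, which preserves the measure. On the event \<open>\<eta> 0 = 0\<close>,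
  \<open>\<eta> m = k\<close>, whose probability is positive and independent of \<open>m\<close>, the difference of the two
  odometers is affine except for kinks of size \<open>k\<close> at \<open>0\<close> and \<open>m\<close>. Some odometer value is then
  of order \<open>m\<close>, which contradicts stationarity as \<open>m\<close> tends to infinity.
\<close>

section \<open>The least odometer\<close>

definition stabilizes_on :: "int set \<Rightarrow> (int \<Rightarrow> nat) \<Rightarrow> config \<Rightarrow> bool" where
  "stabilizes_on A f \<eta> \<longleftrightarrow> (\<forall>y\<in>A. int (\<eta> y) - lap f y \<le> 1)"

text \<open>Only finite windows enter, which makes measurability immediate. The windows are centred at
  the evaluation point, so that translation covariance is immediate as well.\<close>
definition least_odometer :: "config \<Rightarrow> int \<Rightarrow> nat" where
  "least_odometer \<eta> x =
     (LEAST j. \<forall>n. \<exists>f. f x \<le> j \<and> stabilizes_on {x - int n..x + int n} f \<eta>)"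

lemma stabilizes_on_mono: "stabilizes_on B f \<eta> \<Longrightarrow> A \<subseteq> B \<Longrightarrow> stabilizes_on A f \<eta>"
  by (auto simp: stabilizes_on_def)

lemma stabilizes_on_shift:
  "stabilizes_on A (\<lambda>y. f (y + c)) (\<lambda>y. \<eta> (y + c)) \<longleftrightarrow> stabilizes_on ((+) c ` A) f \<eta>"
  by (auto simp: stabilizes_on_def lap_def algebra_simps)

lemma least_odometer_shift:
  "least_odometer (\<lambda>y. \<eta> (y + c)) x = least_odometer \<eta> (x + c)"
proof -
  have "(\<exists>f. f x \<le> j \<and> stabilizes_on {x - int n..x + int n} f (\<lambda>y. \<eta> (y + c))) \<longleftrightarrow>
        (\<exists>f. f (x + c) \<le> j \<and> stabilizes_on {x + c - int n..x + c + int n} f \<eta>)" for j n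
  proof -
    have window: "stabilizes_on {x - int n..x + int n} (\<lambda>y. f (y + c)) (\<lambda>y. \<eta> (y + c)) \<longleftrightarrow>
        stabilizes_on {x + c - int n..x + c + int n} f \<eta>" for f
      unfolding stabilizes_on_shift by (simp add: algebra_simps)
    show ?thesis
    proof (intro iffI; elim exE conjE)
      fix f assume "f x \<le> j" "stabilizes_on {x - int n..x + int n} f (\<lambda>y. \<eta> (y + c))"
      then show "\<exists>f. f (x + c) \<le> j \<and> stabilizes_on {x + c - int n..x + c + int n} f \<eta>"
        using window[of "\<lambda>y. f (y - c)"] by (intro exI[of _ "\<lambda>y. f (y - c)"]) simp
    next
      fix f assume "f (x + c) \<le> j" "stabilizes_on {x + c - int n..x + c + int n} f \<eta>"
      then show "\<exists>f. f x \<le> j \<and> stabilizes_on {x - int n..x + int n} f (\<lambda>y. \<eta> (y + c))"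
        using window[of f] by (intro exI[of _ "\<lambda>y. f (y + c)"]) simp
    qed
  qed
  then show ?thesis
    by (simp add: least_odometer_def)
qed

text \<open>Lowering the neighbours of a site and raising the site itself can only increase
  \<open>lap\<close> there. So it suffices to compare \<open>?F\<close> at each \<open>y\<close>
  with one function \<open>f\<close> that stabilizes a large window around \<open>y\<close>, with
  \<open>f y \<le> ?F y\<close> and neighbouring values at least those of \<open>?F\<close>.\<close>

lemma least_odometer_stabilizes:
  assumes "stabilizes_on UNIV g \<eta>"
  shows "stabilizes_on UNIV (least_odometer \<eta>) \<eta>"
proof -
  let ?W = "\<lambda>x n. {x - int n..x + int n}"
  let ?F = "least_odometer \<eta>"
  have attained: "\<exists>f. f x \<le> ?F x \<and> stabilizes_on (?W x n) f \<eta>" for x n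
  proof -
    have "\<forall>n. \<exists>f. f x \<le> g x \<and> stabilizes_on (?W x n) f \<eta>"
      using assms stabilizes_on_mono by blast
    then show ?thesis
      unfolding least_odometer_def by (rule LeastI2) blast
  qed
  \<comment> \<open>By leastness the value \<open>?F x - 1\<close> already fails on some finite
    window; a window that large forces the lower bound.\<close>
  have minimal: "\<exists>N. \<forall>f. stabilizes_on (?W x N) f \<eta> \<longrightarrow> ?F x \<le> f x" for x
  proof (cases "?F x")
    case (Suc j)
    then have "\<not> (\<forall>n. \<exists>f. f x \<le> j \<and> stabilizes_on (?W x n) f \<eta>)"
      unfolding least_odometer_def by (intro not_less_Least) simp
    then show ?thesis
      using Suc by (metis not_less_eq_eq)
  qed simp
  have "int (\<eta> y) - lap ?F y \<le> 1" for y
  proof -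
    obtain N1 where N1: "\<And>f. stabilizes_on (?W (y - 1) N1) f \<eta> \<Longrightarrow> ?F (y - 1) \<le> f (y - 1)"
      using minimal by blast
    obtain N2 where N2: "\<And>f. stabilizes_on (?W (y + 1) N2) f \<eta> \<Longrightarrow> ?F (y + 1) \<le> f (y + 1)"
      using minimal by blast
    \<comment> \<open>The windows of the neighbours are centred one step off \<open>y\<close>, hence
      the extra 1.\<close>
    define n where "n = N1 + N2 + 1"
    obtain f where f: "f y \<le> ?F y" "stabilizes_on (?W y n) f \<eta>"
      using attained by blast
    have "?F (y - 1) \<le> f (y - 1)" "?F (y + 1) \<le> f (y + 1)"
      by (intro N1 N2 stabilizes_on_mono[OF f(2)]; auto simp: n_def)+
    moreover have "int (\<eta> y) - lap f y \<le> 1"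
      using f(2) by (auto simp: stabilizes_on_def)
    ultimately show ?thesis
      using f(1) by (simp add: lap_def)
  qed
  then show ?thesis
    by (simp add: stabilizes_on_def)
qed

lemma stabilizable_least_odometer:
  assumes "stabilizable \<eta>"
  shows "stabilizes_on UNIV (least_odometer \<eta>) \<eta>"
proof -
  obtain T where "stabilizes_on UNIV (Tinf T) \<eta>"
    using assms by (auto simp: stabilizable_def stabilizes_on_def)
  then show ?thesis
    by (rule least_odometer_stabilizes)
qed

text \<open>Only the values of \<open>f\<close> at \<open>x\<close>, on \<open>A\<close> and next to
  \<open>A\<close> matter. For finite \<open>A\<close> the existential thus ranges over a countable
  set, which gives measurability.\<close>

lemma ex_stabilizes_on_iff:
  "(\<exists>f. f x \<le> j \<and> stabilizes_on A f \<eta>) \<longleftrightarrow>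
   (\<exists>f \<in> {f \<in> (insert x (\<Union>y\<in>A. {y - 1, y, y + 1})) \<rightarrow>\<^sub>E UNIV. f x \<le> j}. stabilizes_on A f \<eta>)"
    (is "_ \<longleftrightarrow> (\<exists>f\<in>{f \<in> ?B \<rightarrow>\<^sub>E UNIV. f x \<le> j}. _)")
proof (intro iffI; elim exE conjE bexE)
  fix f assume f: "f x \<le> j" "stabilizes_on A f \<eta>"
  have "lap (restrict f ?B) y = lap f y" if "y \<in> A" for y
  proof -
    have "{y - 1, y, y + 1} \<subseteq> ?B"
      using that by blast
    then show ?thesis
      by (simp add: lap_def)
  qed
  with f(2) have "stabilizes_on A (restrict f ?B) \<eta>"
    by (simp add: stabilizes_on_def)
  then show "\<exists>f\<in>{f \<in> ?B \<rightarrow>\<^sub>E UNIV. f x \<le> j}. stabilizes_on A f \<eta>"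
    using f(1) by (intro bexI[of _ "restrict f ?B"]) auto
qed auto

lemma measurable_least_odometer:
  assumes [measurable]: "\<And>y. (\<lambda>\<eta>. \<eta> y) \<in> measurable M (count_space UNIV)"
  shows "(\<lambda>\<eta>. least_odometer \<eta> x) \<in> measurable M (count_space UNIV)"
proof -
  have [measurable]: "Measurable.pred M (\<lambda>\<eta>. \<exists>f. f x \<le> j \<and> stabilizes_on A f \<eta>)"
    if "finite A" for j A
  proof -
    let ?B = "insert x (\<Union>y\<in>A. {y - 1, y, y + 1})"
    have "countable (?B \<rightarrow>\<^sub>E (UNIV :: nat set))"
      using that by (intro countable_PiE) auto
    then have *: "countable {f \<in> ?B \<rightarrow>\<^sub>E (UNIV :: nat set). f x \<le> j}"
      by (rule countable_subset[rotated]) auto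
    have [measurable]: "Measurable.pred M (\<lambda>\<eta>. stabilizes_on A f \<eta>)" for f
      unfolding stabilizes_on_def
      using that measurable_compose[OF assms, of "\<lambda>n. int n - lap f _ \<le> 1"]
      by (intro pred_intros_finite) auto
    show ?thesis
      unfolding ex_stabilizes_on_iff Measurable.pred_def
      using * by (intro sets.sets_Collect_countable_Ex') measurable
  qed
  show ?thesis
    unfolding least_odometer_def by measurable
qed

section \<open>Increments of stationary processes\<close>

text \<open>\<open>G\<close> may fail to be integrable, so its increment need not have mean 0. Its
  truncations at level \<open>K\<close> do have mean-zero increments, which turns the claim into
  Fatou for \<open>h K\<close>.\<close>

lemma (in prob_space) nn_integral_stationary_increment_le:
  fixes G :: "'a \<Rightarrow> real"
  assumes [measurable]: "\<tau> \<in> measurable M M" "G \<in> borel_measurable M"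
    and inv: "distr M M \<tau> = M"
    and le: "AE \<omega> in M. G (\<tau> \<omega>) - G \<omega> \<le> c" and "0 \<le> c"
  shows "(\<integral>\<^sup>+\<omega>. ennreal (c - (G (\<tau> \<omega>) - G \<omega>)) \<partial>M) \<le> ennreal c"
proof -
  define cl where "cl K t = max (- real K) (min (real K) t)" for K :: nat and t
  define h where "h K \<omega> = c - (cl K (G (\<tau> \<omega>)) - cl K (G \<omega>))" for K \<omega>
  have [measurable]: "cl K \<in> borel_measurable borel" for K
    unfolding cl_def by measurable
  have [measurable]: "h K \<in> borel_measurable M" for K
    unfolding h_def by measurable
  have bound: "\<bar>cl K t\<bar> \<le> real K" for K t
    by (auto simp: cl_def)
  have int: "integrable M (\<lambda>\<omega>. cl K (G \<omega>))" "integrable M (\<lambda>\<omega>. cl K (G (\<tau> \<omega>)))" for K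
    by (auto intro!: integrable_const_bound[of _ "real K"] simp: bound)
  have "integral\<^sup>L M (h K) = c" for K
  proof -
    have "(\<integral>\<omega>. cl K (G (\<tau> \<omega>)) \<partial>M) = (\<integral>\<omega>. cl K (G \<omega>) \<partial>distr M M \<tau>)"
      by (rule integral_distr[symmetric]) auto
    then show ?thesis
      using int by (simp add: h_def[abs_def] inv prob_space)
  qed
  \<comment> \<open>Truncation is monotone and 1-Lipschitz, so increments stay below
    \<open>c\<close> because \<open>c\<close> is nonnegative.\<close>
  moreover have "AE \<omega> in M. 0 \<le> h K \<omega>" for K
    using le by eventually_elim (use \<open>0 \<le> c\<close> in \<open>auto simp: h_def cl_def\<close>)
  moreover have "integrable M (h K)" for K
    using int by (auto simp: h_def[abs_def])
  ultimately have int_h: "(\<integral>\<^sup>+\<omega>. ennreal (h K \<omega>) \<partial>M) = ennreal c" for K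
    by (simp add: nn_integral_eq_integral)
  have lim: "liminf (\<lambda>K. ennreal (h K \<omega>)) = ennreal (c - (G (\<tau> \<omega>) - G \<omega>))" for \<omega>
  proof (rule lim_imp_Liminf)
    obtain K0 where K0: "\<bar>G \<omega>\<bar> + \<bar>G (\<tau> \<omega>)\<bar> \<le> real K0"
      using real_arch_simple by blast
    have "h K \<omega> = c - (G (\<tau> \<omega>) - G \<omega>)" if "K0 \<le> K" for K
      using that K0 by (auto simp: h_def cl_def)
    then show "(\<lambda>K. ennreal (h K \<omega>)) \<longlonglongrightarrow> ennreal (c - (G (\<tau> \<omega>) - G \<omega>))"
      by (intro tendsto_eventually eventually_sequentiallyI[of K0]) simp
  qed simp
  have "(\<integral>\<^sup>+\<omega>. liminf (\<lambda>K. ennreal (h K \<omega>)) \<partial>M) \<le> liminf (\<lambda>K. \<integral>\<^sup>+\<omega>. ennreal (h K \<omega>) \<partial>M)"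
    by (rule nn_integral_liminf) measurable
  then show ?thesis
    by (simp add: lim int_h Liminf_const)
qed

section \<open>Functions with a kink\<close>

lemma affine_if_second_difference_zero:
  fixes u :: "int \<Rightarrow> int"
  assumes "\<And>x. 0 < x \<Longrightarrow> x < int m \<Longrightarrow> u (x + 1) - 2 * u x + u (x - 1) = 0"
  shows "n \<le> m \<Longrightarrow> u (int n) = u 0 + int n * (u 1 - u 0)"
proof (induction n rule: less_induct)
  case (less n)
  show ?case
  proof (cases "n < 2")
    case False
    then obtain l where n: "n = l + 2"
      by (metis add.commute le_Suc_ex not_less)
    have "u (int (l + 1)) = u 0 + int (l + 1) * (u 1 - u 0)" "u (int l) = u 0 + int l * (u 1 - u 0)"
      by (rule less.IH; use n less.prems in simp)+
    moreover have "u (int (l + 1) + 1) - 2 * u (int (l + 1)) + u (int (l + 1) - 1) = 0"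
      by (rule assms) (use n less.prems in auto)
    ultimately show ?thesis
      by (simp add: n algebra_simps)
  qed (use less_2_cases in fastforce)
qed

text \<open>\<open>u\<close> is affine on both sides of 0 up to distance \<open>m\<close>, and the
  two slopes differ by \<open>k\<close>. Nothing is required at \<open>m\<close> and
  \<open>- m\<close> themselves, so a second kink there is harmless.\<close>

lemma symmetric_difference_kink:
  fixes u :: "int \<Rightarrow> int"
  assumes "\<And>x. \<bar>x\<bar> < int m \<Longrightarrow> x \<noteq> 0 \<Longrightarrow> u (x + 1) - 2 * u x + u (x - 1) = 0"
    and "u 1 - 2 * u 0 + u (- 1) = k"
  shows "u (int m) + u (- int m) - 2 * u 0 = int m * k"
proof -
  have "u (int m) = u 0 + int m * (u 1 - u 0)"
    by (rule affine_if_second_difference_zero[of m]) (use assms(1) in auto)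
  moreover have "u (- int m) = u (- 0) + int m * (u (- 1) - u (- 0))"
    by (rule affine_if_second_difference_zero[of m "\<lambda>x. u (- x)"])
       (use assms(1)[of "- _"] in \<open>auto simp: algebra_simps\<close>)
  ultimately have "u (int m) + u (- int m) - 2 * u 0 = int m * (u 1 - 2 * u 0 + u (- 1))"
    by (simp add: algebra_simps)
  then show ?thesis
    by (simp add: assms(2))
qed

section \<open>Independent heights\<close>

lemma prob_space_iid_measure: "prob_space (iid_measure p)"
  unfolding iid_measure_def by (intro prob_space_PiM prob_space_measure_pmf)

lemma measurable_height [measurable]:
  "(\<lambda>\<eta>. \<eta> x) \<in> measurable (iid_measure p) (count_space UNIV)"
proof -
  have "(\<lambda>\<eta>. \<eta> x) \<in> measurable (iid_measure p) (measure_pmf p)"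
    unfolding iid_measure_def by (rule measurable_component_singleton) simp
  then show ?thesis
    by (simp cong: measurable_cong_sets)
qed

lemma measurable_reindex:
  "(\<lambda>\<eta> x. \<eta> (\<pi> x)) \<in> measurable (iid_measure p) (iid_measure p)"
proof -
  have "(\<lambda>\<eta>. \<eta> (\<pi> x)) \<in> measurable (iid_measure p) (measure_pmf p)" for x
    unfolding iid_measure_def by (rule measurable_component_singleton) simp
  then show ?thesis
    by (subst (2) iid_measure_def) (rule measurable_PiM_single', auto simp: iid_measure_def space_PiM)
qed

text \<open>Serves both for translations and for the exchange of two heights.\<close>

lemma distr_iid_measure_reindex:
  assumes "inj \<pi>"
  shows "distr (iid_measure p) (iid_measure p) (\<lambda>\<eta> x. \<eta> (\<pi> x)) = iid_measure p"
  using distr_PiM_reindex[of UNIV "\<lambda>_. measure_pmf p" \<pi> UNIV] assms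
  by (simp add: iid_measure_def prob_space_measure_pmf restrict_UNIV)

lemma AE_iid_measure_reindex:
  assumes "inj \<pi>" "AE \<eta> in iid_measure p. P \<eta>"
  shows "AE \<eta> in iid_measure p. P (\<lambda>x. \<eta> (\<pi> x))"
  by (rule AE_distrD[OF measurable_reindex], subst distr_iid_measure_reindex)
     (use assms in auto)

lemma measure_iid_measure_reindex:
  assumes "inj \<pi>" "Measurable.pred (iid_measure p) P"
  shows "measure (iid_measure p) {\<eta> \<in> space (iid_measure p). P (\<lambda>x. \<eta> (\<pi> x))} =
         measure (iid_measure p) {\<eta> \<in> space (iid_measure p). P \<eta>}"
proof -
  have "measure (iid_measure p) {\<eta> \<in> space (iid_measure p). P \<eta>} =
        measure (distr (iid_measure p) (iid_measure p) (\<lambda>\<eta> x. \<eta> (\<pi> x)))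
          {\<eta> \<in> space (iid_measure p). P \<eta>}"
    by (simp add: distr_iid_measure_reindex assms(1))
  also have "\<dots> = measure (iid_measure p) {\<eta> \<in> space (iid_measure p). P (\<lambda>x. \<eta> (\<pi> x))}"
    using assms(2) measurable_space[OF measurable_reindex]
    by (subst measure_distr) (auto intro!: arg_cong[where f = "measure _"] measurable_reindex)
  finally show ?thesis ..
qed

lemma nn_integral_height:
  "(\<integral>\<^sup>+\<eta>. h (\<eta> x) \<partial>iid_measure p) = (\<integral>\<^sup>+n. h n \<partial>measure_pmf p)"
proof -
  interpret product_prob_space "\<lambda>_ :: int. measure_pmf p" UNIV
    by unfold_locales
  have "(\<integral>\<^sup>+n. h n \<partial>measure_pmf p) =
        (\<integral>\<^sup>+n. h n \<partial>distr (PiM UNIV (\<lambda>_. measure_pmf p)) (measure_pmf p) (\<lambda>\<eta>. \<eta> x))"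
    by (subst PiM_component) auto
  also have "\<dots> = (\<integral>\<^sup>+\<eta>. h (\<eta> x) \<partial>PiM UNIV (\<lambda>_. measure_pmf p))"
    by (rule nn_integral_distr[OF measurable_component_singleton]) auto
  finally show ?thesis
    by (simp add: iid_measure_def)
qed

lemma measure_two_heights:
  assumes "x \<noteq> y"
  shows "measure (iid_measure p) {\<eta> \<in> space (iid_measure p). \<eta> x = a \<and> \<eta> y = b} = pmf p a * pmf p b"
proof -
  interpret product_prob_space "\<lambda>_ :: int. measure_pmf p" UNIV
    by unfold_locales
  let ?X = "\<lambda>z. if z = x then {a} else {b}"
  have "{\<eta> \<in> space (iid_measure p). \<eta> x = a \<and> \<eta> y = b} =
        prod_emb UNIV (\<lambda>_. measure_pmf p) {x, y} (Pi\<^sub>E {x, y} ?X)"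
    using assms by (auto simp: iid_measure_def prod_emb_def space_PiM PiE_iff)
  then show ?thesis
    using assms measure_PiM_emb[of "{x, y}" ?X]
    by (simp add: iid_measure_def measure_pmf_single)
qed

lemma measurable_least_odometer_iid [measurable]:
  "(\<lambda>\<eta>. least_odometer \<eta> x) \<in> measurable (iid_measure p) (count_space UNIV)"
  by (rule measurable_least_odometer) simp

section \<open>Conservation of density\<close>

text \<open>The slack \<open>1 + L \<eta> - \<eta> 0\<close> is almost surely nonnegative, and
  stationarity leaves no room for a positive mean.\<close>

lemma AE_lap_least_odometer_eq:
  assumes mean: "(\<integral>\<^sup>+n. ennreal (real n) \<partial>measure_pmf p) = 1"
    and stab: "AE \<eta> in iid_measure p. stabilizes_on UNIV (least_odometer \<eta>) \<eta>"
  shows "AE \<eta> in iid_measure p. \<forall>x. lap (least_odometer \<eta>) x = int (\<eta> x) - 1"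
proof -
  let ?M = "iid_measure p"
  interpret prob_space ?M by (rule prob_space_iid_measure)
  define \<tau> :: "config \<Rightarrow> config" where "\<tau> \<eta> = (\<lambda>x. \<eta> (x + 1))" for \<eta>
  define G where "G \<eta> = real (least_odometer \<eta> 0) - real (least_odometer \<eta> (- 1))" for \<eta>
  define L where "L \<eta> = real_of_int (lap (least_odometer \<eta>) 0)" for \<eta>
  have \<tau>_measurable: "\<tau> \<in> measurable ?M ?M"
    unfolding \<tau>_def by (rule measurable_reindex)
  have G_measurable: "G \<in> borel_measurable ?M"
    unfolding G_def by measurable
  have [measurable]: "L \<in> borel_measurable ?M"
    unfolding L_def lap_def by measurable
  have G: "G (\<tau> \<eta>) - G \<eta> = - L \<eta>" for \<eta>
    by (simp add: G_def \<tau>_def L_def least_odometer_shift lap_def)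
  have ge: "AE \<eta> in ?M. real (\<eta> 0) \<le> 1 + L \<eta>"
    using stab
  proof eventually_elim
    case (elim \<eta>)
    then have "int (\<eta> 0) - lap (least_odometer \<eta>) 0 \<le> 1"
      by (simp add: stabilizes_on_def)
    then show ?case
      unfolding L_def by linarith
  qed
  have "(\<integral>\<^sup>+\<eta>. ennreal (1 - (G (\<tau> \<eta>) - G \<eta>)) \<partial>?M) \<le> ennreal 1"
  proof (rule nn_integral_stationary_increment_le[OF \<tau>_measurable G_measurable])
    show "distr ?M ?M \<tau> = ?M"
      unfolding \<tau>_def by (rule distr_iid_measure_reindex) (simp add: inj_def)
    \<comment> \<open>The bound 1 comes from
      \<open>0 \<le> \<eta> 0 \<le> 1 + L \<eta>\<close>.\<close>
    show "AE \<eta> in ?M. G (\<tau> \<eta>) - G \<eta> \<le> 1"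
      using ge by eventually_elim (use G in simp)
  qed simp
  \<comment> \<open>Splitting into height and slack, both nonnegative, avoids any integrability
    question for \<open>L\<close>.\<close>
  also have "(\<integral>\<^sup>+\<eta>. ennreal (1 - (G (\<tau> \<eta>) - G \<eta>)) \<partial>?M) =
      (\<integral>\<^sup>+\<eta>. ennreal (real (\<eta> 0)) + ennreal (1 + L \<eta> - real (\<eta> 0)) \<partial>?M)"
    using ge by (intro nn_integral_cong_AE, eventually_elim) (simp add: G flip: ennreal_plus)
  also have "\<dots> = 1 + (\<integral>\<^sup>+\<eta>. ennreal (1 + L \<eta> - real (\<eta> 0)) \<partial>?M)"
    using nn_integral_height[where h = "\<lambda>n. ennreal (real n)"] mean by (subst nn_integral_add) auto
  finally have "1 + (\<integral>\<^sup>+\<eta>. ennreal (1 + L \<eta> - real (\<eta> 0)) \<partial>?M) \<le> 1 + 0"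
    by simp
  then have "(\<integral>\<^sup>+\<eta>. ennreal (1 + L \<eta> - real (\<eta> 0)) \<partial>?M) = 0"
    unfolding ennreal_add_left_cancel_le by simp
  then have "AE \<eta> in ?M. ennreal (1 + L \<eta> - real (\<eta> 0)) = 0"
    by (subst (asm) nn_integral_0_iff_AE) auto
  with ge have "AE \<eta> in ?M. lap (least_odometer \<eta>) 0 = int (\<eta> 0) - 1"
  proof eventually_elim
    case (elim \<eta>)
    then have "1 + L \<eta> = real (\<eta> 0)"
      by (simp add: ennreal_eq_0_iff)
    then show ?case
      unfolding L_def by linarith
  qed
  \<comment> \<open>Translation carries the identity from site 0 to every site
    \<open>x\<close>.\<close>
  then have "AE \<eta> in ?M. lap (least_odometer \<eta>) x = int (\<eta> x) - 1" for x
    using AE_iid_measure_reindex[where \<pi> = "\<lambda>y. y + x" and p = p and P =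
        "\<lambda>\<eta>. lap (least_odometer \<eta>) 0 = int (\<eta> 0) - 1"]
    by (simp add: lap_def least_odometer_shift inj_def add.commute)
  then show ?thesis
    by (simp add: AE_all_countable)
qed

section \<open>Exchanging two heights\<close>

text \<open>The second difference of \<open>f - f'\<close> is the change of height under the
  exchange: \<open>\<eta> (int m)\<close> at 0, and 0 at all other sites closer than
  \<open>m\<close>. The bound follows by dropping the terms that enter with a minus sign.\<close>

lemma kink_at_exchanged_heights:
  fixes f f' \<eta> :: "int \<Rightarrow> nat"
  assumes f: "\<And>x. lap f x = int (\<eta> x) - 1"
    and f': "\<And>x. lap f' x = int (\<eta> (Transposition.transpose 0 (int m) x)) - 1"
    and "\<eta> 0 = 0" "0 < \<eta> (int m)"
  shows "m \<le> f (int m) + f (- int m) + 2 * f' 0"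
proof -
  define u where "u x = int (f x) - int (f' x)" for x
  have u: "u (x + 1) - 2 * u x + u (x - 1) = int (\<eta> (Transposition.transpose 0 (int m) x)) - int (\<eta> x)" for x
    using f[of x] f'[of x] by (simp add: u_def lap_def)
  have "u (int m) + u (- int m) - 2 * u 0 = int m * int (\<eta> (int m))"
  proof (rule symmetric_difference_kink)
    show "u (x + 1) - 2 * u x + u (x - 1) = 0" if "\<bar>x\<bar> < int m" "x \<noteq> 0" for x
      using that by (auto simp: u Transposition.transpose_def)
    show "u 1 - 2 * u 0 + u (- 1) = int (\<eta> (int m))"
      using u[of 0] \<open>\<eta> 0 = 0\<close> by simp
  qed
  moreover have "int m * 1 \<le> int m * int (\<eta> (int m))"
    using \<open>0 < \<eta> (int m)\<close> by (intro mult_left_mono) auto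
  ultimately show ?thesis
    by (simp add: u_def)
qed

text \<open>The odometer takes finite values, so these decreasing events have empty
  intersection.\<close>

lemma measure_odometer_tail_tendsto_0:
  "(\<lambda>m. measure (iid_measure p) {\<eta> \<in> space (iid_measure p). m \<le> 4 * least_odometer \<eta> 0})
     \<longlonglongrightarrow> 0"
proof -
  let ?M = "iid_measure p"
  interpret prob_space ?M by (rule prob_space_iid_measure)
  let ?A = "\<lambda>m. {\<eta> \<in> space ?M. m \<le> 4 * least_odometer \<eta> 0}"
  have "(\<lambda>m. measure ?M (?A m)) \<longlonglongrightarrow> measure ?M (\<Inter>m. ?A m)"
    by (rule finite_Lim_measure_decseq) (auto simp: decseq_def)
  moreover have "(\<Inter>m. ?A m) = {}"
    using not_less_eq_eq by blast
  ultimately show ?thesis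
    by simp
qed

theorem theorem3p2:
  fixes p :: "nat pmf"
  assumes "(\<integral>\<^sup>+ n. ennreal (real n) \<partial>measure_pmf p) = 1"
    and "pmf p 0 > 0"
  shows "\<not> stabilizable_measure (iid_measure p)"
proof
  let ?M = "iid_measure p" and ?F = least_odometer
  assume "stabilizable_measure ?M"
  then have "AE \<eta> in ?M. stabilizes_on UNIV (?F \<eta>) \<eta>"
    unfolding stabilizable_measure_def
    by eventually_elim (rule stabilizable_least_odometer)
  with assms(1) have exact: "AE \<eta> in ?M. \<forall>x. lap (?F \<eta>) x = int (\<eta> x) - 1"
    by (rule AE_lap_least_odometer_eq)
  interpret prob_space ?M by (rule prob_space_iid_measure)
  \<comment> \<open>Otherwise all heights would vanish, against mean 1.\<close>
  have "\<exists>k>0. 0 < pmf p k"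
  proof (rule ccontr)
    assume *: "\<not> ?thesis"
    have "(\<integral>\<^sup>+ n. ennreal (real n) \<partial>measure_pmf p) = (\<integral>\<^sup>+ n. 0 \<partial>measure_pmf p)"
      using * by (intro nn_integral_cong_AE AE_pmfI) (auto simp: set_pmf_iff pmf_pos)
    with assms(1) show False
      by simp
  qed
  then obtain k where k: "0 < k" "0 < pmf p k"
    by blast
  \<comment> \<open>The kink bound is a sum of three odometer values with weights 1, 1 and 2, so one
    of them is at least \<open>m / 4\<close>.\<close>
  define q where "q m = measure ?M {\<eta> \<in> space ?M. m \<le> 4 * ?F \<eta> 0}" for m
  have bound: "pmf p 0 * pmf p k \<le> 3 * q m" if "0 < m" for m
  proof -
    let ?\<sigma> = "Transposition.transpose 0 (int m)"
    let ?E = "{\<eta> \<in> space ?M. \<eta> 0 = 0 \<and> \<eta> (int m) = k}"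
    let ?A = "{\<eta> \<in> space ?M. m \<le> 4 * ?F \<eta> (int m)}"
    let ?B = "{\<eta> \<in> space ?M. m \<le> 4 * ?F \<eta> (- int m)}"
    let ?C = "{\<eta> \<in> space ?M. m \<le> 4 * ?F (\<lambda>x. \<eta> (?\<sigma> x)) 0}"
    have [measurable]: "(\<lambda>\<eta>. ?F (\<lambda>x. \<eta> (?\<sigma> x)) 0) \<in> measurable ?M (count_space UNIV)"
      by (rule measurable_compose[OF measurable_reindex measurable_least_odometer_iid])
    \<comment> \<open>Both the shifted and the exchanged odometer are the odometer of a reindexed
      configuration, so all three events below have probability \<open>q m\<close>.\<close>
    have eq: "measure ?M {\<eta> \<in> space ?M. m \<le> 4 * ?F (\<lambda>x. \<eta> (\<pi> x)) 0} = q m" if "inj \<pi>" for \<pi>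
      unfolding q_def using that by (rule measure_iid_measure_reindex) measurable
    have shift: "measure ?M {\<eta> \<in> space ?M. m \<le> 4 * ?F \<eta> c} = q m" for c
      using eq[of "\<lambda>x. x + c"] by (simp add: least_odometer_shift inj_def)
    have "AE \<eta> in ?M. \<forall>x. lap (?F (\<lambda>x. \<eta> (?\<sigma> x))) x = int (\<eta> (?\<sigma> x)) - 1"
      by (rule AE_iid_measure_reindex[OF _ exact]) simp
    with exact have "AE \<eta> in ?M. \<eta> \<in> ?E \<longrightarrow> \<eta> \<in> ?A \<union> (?B \<union> ?C)"
    proof eventually_elim
      case (elim \<eta>)
      have "m \<le> ?F \<eta> (int m) + ?F \<eta> (- int m) + 2 * ?F (\<lambda>x. \<eta> (?\<sigma> x)) 0"
        if "\<eta> 0 = 0" "\<eta> (int m) = k"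
        using kink_at_exchanged_heights[of "?F \<eta>" \<eta> "?F (\<lambda>x. \<eta> (?\<sigma> x))" m] elim that k by simp
      then show ?case
        by auto
    qed
    then have "measure ?M ?E \<le> measure ?M (?A \<union> (?B \<union> ?C))"
      by (rule finite_measure_mono_AE) measurable
    also have "\<dots> \<le> measure ?M ?A + (measure ?M ?B + measure ?M ?C)"
      by (intro order_trans[OF measure_Un_le] add_left_mono
          measure_Un_le) measurable
    also have "\<dots> = 3 * q m"
      using shift eq[of ?\<sigma>] by simp
    finally show ?thesis
      using \<open>0 < m\<close> by (simp add: measure_two_heights)
  qed
  have "q \<longlonglongrightarrow> 0"
    unfolding q_def by (rule measure_odometer_tail_tendsto_0)
  then have "(\<lambda>m. 3 * q m) \<longlonglongrightarrow> 0"
    by (simp add: tendsto_mult_right_zero)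
  \<comment> \<open>The left-hand side does not depend on \<open>m\<close>, so the bound passes to
    the limit.\<close>
  then have "pmf p 0 * pmf p k \<le> 0"
    by (rule tendsto_lowerbound) (use bound in \<open>auto intro: eventually_at_top_linorderI[of 1]\<close>)
  with assms(2) k(2) show False
    by (simp add: mult_le_0_iff)
qed

end
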